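(* Let $D$ be a P$\star$MD, where $\star$ is a semistar operation on $D$. The following are equivalent. (i) $D$ is a $\star_f$-doublesharp domain. (ii) If $T$ is an overring of $D$ and $\star'$ is a semistar operation on $T$ such that $T$ is $(\star,\star')$-linked to $D$, then $T$ is a $\star'_f$-sharp domain. (iii) If $T$ is a $(\star,t_T)$-linked overring of $D$, then $T$ is a $t_T$-sharp domain.
   Context: Let $D$ be an integral domain with quotient field $K$. Denote by $\overline{\boldsymbol F}(D)$ the set of nonzero $D$-submodules of $K$ and by $\boldsymbol f(D)$ the set of nonzero finitely generated $D$-submodules of $K$. An overring of a domain is a ring between the domain and its quotient field (both included). A semistar operation on $D$ is a map $\star:\overline{\boldsymbol F}(D)\to\overline{\boldsymbol F}(D)$, $E\mapsto E^\star$, such that for all $0\ne x\in K$ and $E,F\in\overline{\boldsymbol F}(D)$: $(xE)^\star=xE^\star$; $E\subseteq F$ implies $E^\star\subseteq F^\star$; $E\subseteq E^\star$ and $(E^\star)^\star=E^\star$. The associated finite-type operation is $E^{\star_f}:=\bigcup\{F^\star\mid F\in\boldsymbol f(D),\,F\subseteq E\}$. P$\star$MD: $D$ is a P$\star$MD if $(FF^{-1})^{\star_f}=D^{\star}$ for every $F\in\boldsymbol f(D)$, where $F^{-1}=(D:_KF)$. A nonzero ideal $I$ of $D$ is a quasi-$\star$-ideal if $I^\star\cap D=I$. $\mathrm{QSpec}^{\star}(D)$ is the set of prime quasi-$\star$-ideals, and $\mathrm{QMax}^{\star}(D)$ the set of ideals maximal among the proper quasi-$\star$-ideals. Sharpness: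 for $P\in\mathrm{QSpec}^{\star_f}(D)$ put $\nabla^{\star_f}(P):=\{M\in\mathrm{QMax}^{\star_f}(D)\mid M\nsupseteq P\}$ and $\Theta^{\star_f}(P):=\bigcap\{D_M\mid M\in\nabla^{\star_f}(P)\}$ (an empty intersection is $K$). $P$ is $\star_f$-sharp if $\Theta^{\star_f}(P)\nsubseteq D_P$. $D$ is a $\star_f$-sharp domain if every $M\in\mathrm{QMax}^{\star_f}(D)$ is $\star_f$-sharp, and a $\star_f$-doublesharp domain if every $P\in\mathrm{QSpec}^{\star_f}(D)$ is $\star_f$-sharp. The same definitions apply to an overring $T$ with a semistar operation $\star'$ on $T$ (and to $t_T$, which is of finite type). For a domain $T$, $v_T$ is the operation $E^{v_T}=(T:(T:E))$ (colons in the quotient field of $T$) and $t_T:=(v_T)_f$. Linkedness: if $T$ is an overring of $D$ and $\star,\star'$ are semistar operations on $D,T$ respectively, then $T$ is $(\star,\star')$-linked to $D$ if, for every nonzero finitely generated integral ideal $F$ of $D$, $F^\star=D^\star$ implies $(FT)^{\star'}=T^{\star'}$. *)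

theory Defs
  imports Complex_Main
begin

text \<open>
  The quotient field is the type \<open>'k::field\<close>, that is \<open>K = UNIV\<close>.  A domain \<open>D\<close> with quotient
  field \<open>K\<close>, its overrings, and the \<open>D\<close>-submodules of \<open>K\<close> are subsets of \<open>'k\<close>.
  Operations on submodules are total functions on sets; only their values on nonzero
  submodules of \<open>K\<close> are constrained or used.
\<close>

definition is_subring :: "'k::field set \<Rightarrow> bool" where
  "is_subring D \<longleftrightarrow> 1 \<in> D \<and> (\<forall>x\<in>D. \<forall>y\<in>D. x - y \<in> D \<and> x * y \<in> D)"

definition domain_with_quotient_field :: "'k::field set \<Rightarrow> bool" where
  "domain_with_quotient_field D \<longleftrightarrow>
     is_subring D \<and> (\<forall>z. \<exists>a\<in>D. \<exists>b\<in>D. b \<noteq> 0 \<and> z = a / b)"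

definition overring :: "'k::field set \<Rightarrow> 'k set \<Rightarrow> bool" where
  "overring D T \<longleftrightarrow> is_subring T \<and> D \<subseteq> T"

definition is_submodule :: "'k::field set \<Rightarrow> 'k set \<Rightarrow> bool" where
  "is_submodule D E \<longleftrightarrow>
     0 \<in> E \<and> (\<forall>x\<in>E. \<forall>y\<in>E. x + y \<in> E) \<and> (\<forall>d\<in>D. \<forall>x\<in>E. d * x \<in> E)"

definition Fbar :: "'k::field set \<Rightarrow> 'k set set" where
  "Fbar D = {E. is_submodule D E \<and> E \<noteq> {0}}"

definition fgmod :: "'k::field set \<Rightarrow> 'k set set" where
  "fgmod D = {E \<in> Fbar D. \<exists>S. finite S \<and> E = is_submodule D hull S}"

definition mod_mult :: "'k::field set \<Rightarrow> 'k set \<Rightarrow> 'k set" where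
  "mod_mult E F = {\<Sum>i<n. x i * y i | (n::nat) x y. \<forall>i<n. x i \<in> E \<and> y i \<in> F}"

text \<open>\<open>colon E F\<close> is \<open>(E :\<^sub>K F)\<close>.\<close>

definition colon :: "'k::field set \<Rightarrow> 'k set \<Rightarrow> 'k set" where
  "colon E F = {x. \<forall>y\<in>F. x * y \<in> E}"

definition semistar :: "'k::field set \<Rightarrow> ('k set \<Rightarrow> 'k set) \<Rightarrow> bool" where
  "semistar D star \<longleftrightarrow>
     (\<forall>E\<in>Fbar D. star E \<in> Fbar D) \<and>
     (\<forall>x. x \<noteq> 0 \<longrightarrow> (\<forall>E\<in>Fbar D. star ((*) x ` E) = (*) x ` star E)) \<and>
     (\<forall>E\<in>Fbar D. \<forall>F\<in>Fbar D. E \<subseteq> F \<longrightarrow> star E \<subseteq> star F) \<and>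
     (\<forall>E\<in>Fbar D. E \<subseteq> star E \<and> star (star E) = star E)"

definition finite_type :: "'k::field set \<Rightarrow> ('k set \<Rightarrow> 'k set) \<Rightarrow> 'k set \<Rightarrow> 'k set" where
  "finite_type D star E = \<Union> {star F | F. F \<in> fgmod D \<and> F \<subseteq> E}"

definition PstarMD :: "'k::field set \<Rightarrow> ('k set \<Rightarrow> 'k set) \<Rightarrow> bool" where
  "PstarMD D star \<longleftrightarrow>
     (\<forall>F\<in>fgmod D. finite_type D star (mod_mult F (colon D F)) = star D)"

definition v_op :: "'k::field set \<Rightarrow> 'k set \<Rightarrow> 'k set" where
  "v_op T E = colon T (colon T E)"

definition t_op :: "'k::field set \<Rightarrow> 'k set \<Rightarrow> 'k set" where
  "t_op T = finite_type T (v_op T)"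

definition is_ideal :: "'k::field set \<Rightarrow> 'k set \<Rightarrow> bool" where
  "is_ideal D I \<longleftrightarrow> is_submodule D I \<and> I \<subseteq> D"

definition is_prime_ideal :: "'k::field set \<Rightarrow> 'k set \<Rightarrow> bool" where
  "is_prime_ideal D P \<longleftrightarrow>
     is_ideal D P \<and> P \<noteq> D \<and> (\<forall>a\<in>D. \<forall>b\<in>D. a * b \<in> P \<longrightarrow> a \<in> P \<or> b \<in> P)"

definition quasi_ideal :: "'k::field set \<Rightarrow> ('k set \<Rightarrow> 'k set) \<Rightarrow> 'k set \<Rightarrow> bool" where
  "quasi_ideal D star I \<longleftrightarrow> is_ideal D I \<and> I \<noteq> {0} \<and> star I \<inter> D = I"

definition QSpec :: "'k::field set \<Rightarrow> ('k set \<Rightarrow> 'k set) \<Rightarrow> 'k set set" where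
  "QSpec D star = {P. is_prime_ideal D P \<and> quasi_ideal D star P}"

definition QMax :: "'k::field set \<Rightarrow> ('k set \<Rightarrow> 'k set) \<Rightarrow> 'k set set" where
  "QMax D star = {M. quasi_ideal D star M \<and> M \<noteq> D \<and>
     (\<forall>I. quasi_ideal D star I \<and> I \<noteq> D \<and> M \<subseteq> I \<longrightarrow> I = M)}"

definition localization :: "'k::field set \<Rightarrow> 'k set \<Rightarrow> 'k set" where
  "localization D P = {a / s | a s. a \<in> D \<and> s \<in> D - P}"

text \<open>
  The operation argument of the following notions is the finite-type operation itself,
  for example \<open>finite_type D star\<close> or \<open>t_op T\<close>.  The empty intersection in \<open>Theta\<close> is
  \<open>UNIV\<close>, the whole quotient field.
\<close>

definition nabla :: "'k::field set \<Rightarrow> ('k set \<Rightarrow> 'k set) \<Rightarrow> 'k set \<Rightarrow> 'k set set" where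
  "nabla D s P = {M \<in> QMax D s. \<not> P \<subseteq> M}"

definition Theta :: "'k::field set \<Rightarrow> ('k set \<Rightarrow> 'k set) \<Rightarrow> 'k set \<Rightarrow> 'k set" where
  "Theta D s P = (\<Inter>M\<in>nabla D s P. localization D M)"

definition sharp_prime :: "'k::field set \<Rightarrow> ('k set \<Rightarrow> 'k set) \<Rightarrow> 'k set \<Rightarrow> bool" where
  "sharp_prime D s P \<longleftrightarrow> \<not> Theta D s P \<subseteq> localization D P"

definition sharp_domain :: "'k::field set \<Rightarrow> ('k set \<Rightarrow> 'k set) \<Rightarrow> bool" where
  "sharp_domain D s \<longleftrightarrow> (\<forall>M\<in>QMax D s. sharp_prime D s M)"

definition doublesharp_domain :: "'k::field set \<Rightarrow> ('k set \<Rightarrow> 'k set) \<Rightarrow> bool" where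
  "doublesharp_domain D s \<longleftrightarrow> (\<forall>P\<in>QSpec D s. sharp_prime D s P)"

definition linked ::
    "'k::field set \<Rightarrow> ('k set \<Rightarrow> 'k set) \<Rightarrow> 'k set \<Rightarrow> ('k set \<Rightarrow> 'k set) \<Rightarrow> bool" where
  "linked D star T star' \<longleftrightarrow>
     (\<forall>F\<in>fgmod D. F \<subseteq> D \<longrightarrow> star F = star D \<longrightarrow> star' (mod_mult F T) = star' T)"

end

theory Submission
  imports Defs
begin

text \<open>
  Write \<open>s = \<star>\<^sub>f\<close>. In a P\<open>\<star>\<close>MD every \<open>Q \<in> QSpec\<^sup>s(D)\<close> has a valuation ring \<open>D\<^sub>Q\<close> as
  localization, and every nonzero prime below some \<open>M \<in> QMax\<^sup>s(D)\<close> is again in \<open>QSpec\<^sup>s(D)\<close>.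
  Hence, if \<open>T\<close> is linked, contraction \<open>N \<mapsto> P = N \<inter> D\<close> maps \<open>QMax(T)\<close> to pairwise incomparable
  members of \<open>QSpec\<^sup>s(D)\<close> with \<open>T\<^sub>N = D\<^sub>P\<close>. If \<open>N' \<noteq> N\<close> contracts to \<open>P' \<subseteq> M \<in> QMax\<^sup>s(D)\<close>, then
  \<open>P \<subseteq> M\<close> is impossible because primes below \<open>M\<close> form a chain; so \<open>\<Theta>(P) \<subseteq> D\<^sub>M \<subseteq> T\<^bsub>N'\<^esub>\<close> and sharpness
  of \<open>P\<close> passes to \<open>N\<close>. Conversely, if \<open>P\<close> is not sharp, the overring \<open>\<Theta>(P)\<close> is linked but
  not \<open>t\<close>-sharp.
\<close>

section \<open>Submodules of the quotient field\<close>

lemma subringD: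
  assumes "is_subring D"
  shows "1 \<in> D" "0 \<in> D" "x \<in> D \<Longrightarrow> - x \<in> D" "x \<in> D \<Longrightarrow> y \<in> D \<Longrightarrow> x + y \<in> D"
    "x \<in> D \<Longrightarrow> y \<in> D \<Longrightarrow> x - y \<in> D" "x \<in> D \<Longrightarrow> y \<in> D \<Longrightarrow> x * y \<in> D"
proof -
  show one: "1 \<in> D" and diff: "\<And>x y. x \<in> D \<Longrightarrow> y \<in> D \<Longrightarrow> x - y \<in> D"
    and "x \<in> D \<Longrightarrow> y \<in> D \<Longrightarrow> x * y \<in> D"
    using assms by (auto simp: is_subring_def)
  show zero: "0 \<in> D"
    using diff[OF one one] by simp
  show neg: "\<And>x. x \<in> D \<Longrightarrow> - x \<in> D"
    using diff[OF zero] by simp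
  show "x \<in> D \<Longrightarrow> y \<in> D \<Longrightarrow> x + y \<in> D"
    using diff[of x "- y"] neg by simp
qed

lemma submoduleD:
  assumes "is_submodule D E"
  shows "0 \<in> E" "x \<in> E \<Longrightarrow> y \<in> E \<Longrightarrow> x + y \<in> E" "d \<in> D \<Longrightarrow> x \<in> E \<Longrightarrow> d * x \<in> E"
  using assms by (auto simp: is_submodule_def)

lemma submodule_subring: "is_subring D \<Longrightarrow> is_submodule D D"
  by (auto simp: is_submodule_def subringD)

lemma submodule_restrict: "is_submodule T E \<Longrightarrow> D \<subseteq> T \<Longrightarrow> is_submodule D E"
  by (auto simp: is_submodule_def)

lemma submodule_Int: "is_submodule D E \<Longrightarrow> is_submodule D F \<Longrightarrow> is_submodule D (E \<inter> F)"
  by (auto simp: is_submodule_def)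

lemma submodule_scale: "is_submodule D E \<Longrightarrow> is_submodule D ((*) x ` E)"
  unfolding is_submodule_def
  by (auto simp: distrib_left[symmetric] mult.left_commute[of _ x])

lemma submodule_unscale: "is_submodule D E \<Longrightarrow> is_submodule D {y. x * y \<in> E}"
  by (auto simp: is_submodule_def distrib_left mult.left_commute)

lemma submodule_principal: "is_subring D \<Longrightarrow> is_submodule D ((*) a ` D)"
  by (simp add: submodule_scale submodule_subring)

lemma submodule_hull: "is_submodule D (is_submodule D hull S)"
  by (rule hull_in) (auto simp: is_submodule_def)

lemma hull_le_iff: "is_submodule D E \<Longrightarrow> is_submodule D hull S \<subseteq> E \<longleftrightarrow> S \<subseteq> E"
  by (meson hull_minimal hull_subset order_trans)

text \<open>Both inclusions are minimality of a hull. The second compares the hull of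
  \<open>S\<close> with the preimage of a submodule under multiplication by \<open>x\<close>, so
  \<open>x\<close> is never inverted.\<close>

lemma hull_scale: "is_submodule D hull ((*) x ` S) = (*) x ` (is_submodule D hull S)"
proof
  show "is_submodule D hull ((*) x ` S) \<subseteq> (*) x ` (is_submodule D hull S)"
    by (simp add: hull_le_iff submodule_scale submodule_hull image_mono hull_subset)
  have "is_submodule D hull S \<subseteq> {y. x * y \<in> is_submodule D hull ((*) x ` S)}"
    by (subst hull_le_iff) (auto intro: submodule_unscale submodule_hull hull_inc)
  then show "(*) x ` (is_submodule D hull S) \<subseteq> is_submodule D hull ((*) x ` S)"
    by auto
qed

lemma FbarI: "is_submodule D E \<Longrightarrow> x \<in> E \<Longrightarrow> x \<noteq> 0 \<Longrightarrow> E \<in> Fbar D"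
  by (auto simp: Fbar_def)

lemma FbarD: "E \<in> Fbar D \<Longrightarrow> is_submodule D E"
  by (auto simp: Fbar_def)

lemma Fbar_nonzero: "E \<in> Fbar D \<Longrightarrow> \<exists>x\<in>E. x \<noteq> 0"
  by (auto simp: Fbar_def is_submodule_def)

lemma Fbar_subring: "is_subring D \<Longrightarrow> D \<in> Fbar D"
  by (rule FbarI[of _ _ 1]) (auto simp: submodule_subring subringD)

lemma Fbar_scale:
  assumes "E \<in> Fbar D" "x \<noteq> 0"
  shows "(*) x ` E \<in> Fbar D"
proof -
  obtain e where "e \<in> E" "e \<noteq> 0"
    using Fbar_nonzero assms by blast
  with assms show ?thesis
    by (intro FbarI[of _ _ "x * e"] submodule_scale) (auto simp: FbarD)
qed

section \<open>Finitely generated submodules\<close>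

lemma fgmodI: "finite S \<Longrightarrow> x \<in> S \<Longrightarrow> x \<noteq> 0 \<Longrightarrow> is_submodule D hull S \<in> fgmod D"
  unfolding fgmod_def by (auto intro!: FbarI[of _ _ x] submodule_hull hull_inc)

lemma fgmod_Fbar: "F \<in> fgmod D \<Longrightarrow> F \<in> Fbar D"
  by (auto simp: fgmod_def)

lemma fgmodE:
  assumes "F \<in> fgmod D"
  obtains S x where "finite S" "F = is_submodule D hull S" "x \<in> S" "x \<noteq> 0"
proof -
  obtain S where S: "finite S" "F = is_submodule D hull S" and F: "F \<in> Fbar D"
    using assms by (auto simp: fgmod_def)
  have "\<not> S \<subseteq> {0}"
  proof
    assume "S \<subseteq> {0}"
    then have "F \<subseteq> {0}"
      unfolding S by (subst hull_le_iff) (auto simp: is_submodule_def)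
    with Fbar_nonzero[OF F] show False by auto
  qed
  with S that show thesis by blast
qed

lemma fgmod_scale:
  assumes "F \<in> fgmod D" "x \<noteq> 0"
  shows "(*) x ` F \<in> fgmod D"
  using assms(1)
proof (rule fgmodE)
  fix S y assume "finite S" "F = is_submodule D hull S" "y \<in> S" "y \<noteq> 0"
  with assms show ?thesis
    by (auto simp: hull_scale[symmetric] intro!: fgmodI[of _ "x * y"])
qed

text \<open>Joining the two generating sets shows that the finitely generated submodules of
  \<open>E\<close> are directed, so the union that defines \<open>finite_type\<close> is a directed
  one.\<close>

lemma fgmod_sup:
  assumes "F \<in> fgmod D" "G \<in> fgmod D" "F \<subseteq> E" "G \<subseteq> E" "is_submodule D E"
  shows "\<exists>H\<in>fgmod D. F \<subseteq> H \<and> G \<subseteq> H \<and> H \<subseteq> E"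
proof -
  obtain S x where S: "finite S" "F = is_submodule D hull S" "x \<in> S" "x \<noteq> 0"
    using assms(1) by (rule fgmodE)
  obtain R y where R: "finite R" "G = is_submodule D hull R" "y \<in> R" "y \<noteq> 0"
    using assms(2) by (rule fgmodE)
  have "is_submodule D hull (S \<union> R) \<in> fgmod D"
    using S R by (intro fgmodI[of _ x]) auto
  moreover have "F \<subseteq> is_submodule D hull (S \<union> R)" "G \<subseteq> is_submodule D hull (S \<union> R)"
    unfolding S R by (simp_all add: hull_mono)
  moreover have "is_submodule D hull (S \<union> R) \<subseteq> E"
    using assms S R by (simp add: hull_le_iff)
  ultimately show ?thesis by blast
qed

lemma hull_singleton:
  assumes "is_subring D"
  shows "is_submodule D hull {a} = (*) a ` D"
proof
  show "is_submodule D hull {a} \<subseteq> (*) a ` D"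
    using assms by (subst hull_le_iff) (auto simp: submodule_principal image_iff subringD intro!: bexI[of _ 1])
  show "(*) a ` D \<subseteq> is_submodule D hull {a}"
    by (metis (no_types, lifting) hull_inc image_subsetI insertI1 mult.commute submoduleD(3) submodule_hull)
qed

lemma fgmod_principal: "is_subring D \<Longrightarrow> a \<noteq> 0 \<Longrightarrow> (*) a ` D \<in> fgmod D"
  by (metis finite.emptyI finite.insertI fgmodI hull_singleton insertI1)

lemma fgmod_subring: "is_subring D \<Longrightarrow> D \<in> fgmod D"
  using fgmod_principal[of D 1] by simp

section \<open>Products of modules and extension to an overring\<close>

lemma mod_mult_le:
  assumes "is_submodule T E" "\<And>a b. a \<in> A \<Longrightarrow> b \<in> B \<Longrightarrow> a * b \<in> E"
  shows "mod_mult A B \<subseteq> E"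
proof -
  have "(\<Sum>i<n. x i * y i) \<in> E" if "\<forall>i<n. x i \<in> A \<and> y i \<in> B" for n :: nat and x y
    using that by (induction n) (auto simp: submoduleD[OF assms(1)] assms(2))
  then show ?thesis by (auto simp: mod_mult_def)
qed

lemma mod_mult_inc:
  assumes "a \<in> A" "b \<in> B"
  shows "a * b \<in> mod_mult A B"
  unfolding mod_mult_def mem_Collect_eq using assms
  by (intro exI[of _ 1] exI[of _ "\<lambda>_. a"] exI[of _ "\<lambda>_. b"]) auto

lemma submodule_mod_mult:
  assumes "\<And>d b. d \<in> T \<Longrightarrow> b \<in> B \<Longrightarrow> d * b \<in> B"
  shows "is_submodule T (mod_mult A B)"
  unfolding is_submodule_def
proof (intro conjI ballI)
  show "0 \<in> mod_mult A B"
    unfolding mod_mult_def mem_Collect_eq by (intro exI[of _ 0]) auto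
next
  fix p q assume "p \<in> mod_mult A B" and q: "q \<in> mod_mult A B"
  then obtain m x y where p: "p = (\<Sum>i<m::nat. x i * y i)" "\<forall>i<m. x i \<in> A \<and> y i \<in> B"
    unfolding mod_mult_def by blast
  obtain n x' y' where q: "q = (\<Sum>i<n::nat. x' i * y' i)" "\<forall>i<n. x' i \<in> A \<and> y' i \<in> B"
    using q unfolding mod_mult_def by blast
  \<comment> \<open>The two sums are concatenated: the first \<open>m\<close> indices carry
    \<open>p\<close>, the next \<open>n\<close>, shifted by \<open>m\<close>, carry
    \<open>q\<close>.\<close>
  let ?x = "\<lambda>i. if i < m then x i else x' (i - m)" and ?y = "\<lambda>i. if i < m then y i else y' (i - m)"
  have "(\<Sum>i<m + k. ?x i * ?y i) = p + (\<Sum>i<k. x' i * y' i)" for k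
    by (induction k) (auto simp: p algebra_simps)
  then have "p + q = (\<Sum>i<m + n. ?x i * ?y i)"
    by (simp add: q)
  then show "p + q \<in> mod_mult A B"
    unfolding mod_mult_def mem_Collect_eq using p q
    by (intro exI[of _ "m + n"] exI[of _ ?x] exI[of _ ?y]) auto
next
  fix d p assume d: "d \<in> T" and "p \<in> mod_mult A B"
  then obtain n x y where p: "p = (\<Sum>i<n::nat. x i * y i)" "\<forall>i<n. x i \<in> A \<and> y i \<in> B"
    unfolding mod_mult_def by blast
  then show "d * p \<in> mod_mult A B"
    unfolding mod_mult_def mem_Collect_eq using assms d
    by (intro exI[of _ n] exI[of _ x] exI[of _ "\<lambda>i. d * y i"])
      (auto simp: sum_distrib_left mult.left_commute)
qed

lemma mod_mult_overring_le:
  assumes "D \<subseteq> T" "is_submodule T E" "F \<subseteq> E"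
  shows "mod_mult F T \<subseteq> E"
proof (rule mod_mult_le[OF assms(2)])
  fix a b assume "a \<in> F" "b \<in> T"
  then have "b * a \<in> E" using assms by (auto intro: submoduleD)
  then show "a * b \<in> E" by (simp add: mult.commute)
qed

lemma mod_mult_overring_inc: "is_subring T \<Longrightarrow> F \<subseteq> mod_mult F T"
  using mod_mult_inc[of _ F 1 T] by (auto simp: subringD)

text \<open>Generators of \<open>F\<close> over \<open>D\<close> generate \<open>FT\<close> over
  \<open>T\<close>, so \<open>FT\<close> is admissible in the union defining a finite-type operation
  on \<open>T\<close>.\<close>

lemma fgmod_mod_mult:
  assumes "overring D T" "F \<in> fgmod D"
  shows "mod_mult F T \<in> fgmod T"
proof -
  have T: "is_subring T" "D \<subseteq> T"
    using assms by (auto simp: overring_def)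
  obtain S x where S: "finite S" "F = is_submodule D hull S" "x \<in> S" "x \<noteq> 0"
    using assms(2) by (rule fgmodE)
  have sub: "is_submodule T (mod_mult F T)"
    using T by (intro submodule_mod_mult) (simp add: subringD)
  have "mod_mult F T = is_submodule T hull S"
  proof
    show "mod_mult F T \<subseteq> is_submodule T hull S"
      using T S by (intro mod_mult_overring_le[OF T(2)] submodule_hull)
        (auto simp: hull_le_iff[OF submodule_restrict[OF submodule_hull T(2)]] hull_subset)
    show "is_submodule T hull S \<subseteq> mod_mult F T"
      using mod_mult_overring_inc[OF T(1), of F] S sub hull_subset[of S "is_submodule D"]
      by (simp add: hull_le_iff)
  qed
  then show ?thesis using S fgmodI by metis
qed

section \<open>Semistar operations of finite type\<close>

lemma semistarD:
  assumes "semistar D star"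
  shows "E \<in> Fbar D \<Longrightarrow> star E \<in> Fbar D"
    "E \<in> Fbar D \<Longrightarrow> x \<noteq> 0 \<Longrightarrow> star ((*) x ` E) = (*) x ` star E"
    "E \<in> Fbar D \<Longrightarrow> F \<in> Fbar D \<Longrightarrow> E \<subseteq> F \<Longrightarrow> star E \<subseteq> star F"
    "E \<in> Fbar D \<Longrightarrow> E \<subseteq> star E"
    "E \<in> Fbar D \<Longrightarrow> star (star E) = star E"
  using assms by (auto simp: semistar_def)

lemma star_le_star:
  assumes "semistar D star" "E \<in> Fbar D" "F \<in> Fbar D" "E \<subseteq> star F"
  shows "star E \<subseteq> star F"
  using semistarD(3)[OF assms(1,2) semistarD(1)[OF assms(1,3)] assms(4)]
  by (simp add: semistarD(5)[OF assms(1,3)])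

text \<open>The module \<open>star F\<close> is closed under multiplication by \<open>D\<close>, so
  it contains \<open>D\<close> as soon as it contains 1. This supplies the premise on
  \<open>F\<close> in \<open>linked\<close>.\<close>

lemma star_eq_if_one:
  assumes "is_subring D" "semistar D star" "F \<in> Fbar D" "F \<subseteq> D" "1 \<in> star F"
  shows "star F = star D"
proof
  show "star F \<subseteq> star D"
    using assms by (intro semistarD(3)[OF assms(2)]) (simp_all add: Fbar_subring)
  have "D \<subseteq> star F"
  proof
    fix d assume "d \<in> D"
    then show "d \<in> star F"
      using submoduleD(3)[OF FbarD[OF semistarD(1)[OF assms(2,3)]] _ assms(5)] by simp
  qed
  then show "star D \<subseteq> star F"
    using assms by (intro star_le_star[OF assms(2)]) (simp_all add: Fbar_subring)
qed

lemma mem_finite_type: "x \<in> finite_type D star E \<longleftrightarrow> (\<exists>F\<in>fgmod D. F \<subseteq> E \<and> x \<in> star F)"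
  by (auto simp: finite_type_def)

lemma finite_type_mono: "E \<subseteq> F \<Longrightarrow> finite_type D star E \<subseteq> finite_type D star F"
  unfolding finite_type_def by blast

lemma finite_type_fgmod:
  assumes "semistar D star" "F \<in> fgmod D"
  shows "finite_type D star F = star F"
proof
  show "finite_type D star F \<subseteq> star F"
    using semistarD(3)[OF assms(1) fgmod_Fbar fgmod_Fbar[OF assms(2)]]
    unfolding finite_type_def by blast
  show "star F \<subseteq> finite_type D star F"
    using assms(2) unfolding finite_type_def by blast
qed

text \<open>By directedness, finitely many elements of the union already lie in a single
  \<open>star F\<close>. This carries both closure under sums and idempotence of
  \<open>finite_type\<close>.\<close>

lemma finite_type_finite_subset:
  assumes "semistar D star" "E \<in> Fbar D" "finite A" "A \<subseteq> finite_type D star E"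
  shows "\<exists>F\<in>fgmod D. F \<subseteq> E \<and> A \<subseteq> star F"
  using assms(3,4)
proof induction
  \<comment> \<open>A witness is needed even here, and it must be nonzero to belong to
    \<open>fgmod D\<close>.\<close>
  case empty
  obtain e where e: "e \<in> E" "e \<noteq> 0"
    using Fbar_nonzero assms by blast
  then have "is_submodule D hull {e} \<in> fgmod D" "is_submodule D hull {e} \<subseteq> E"
    using assms by (auto simp: hull_le_iff FbarD intro: fgmodI)
  then show ?case by blast
next
  case (insert a A)
  then obtain F G where F: "F \<in> fgmod D" "F \<subseteq> E" "A \<subseteq> star F"
    and G: "G \<in> fgmod D" "G \<subseteq> E" "a \<in> star G"
    by (auto simp: mem_finite_type)
  obtain H where H: "H \<in> fgmod D" "F \<subseteq> H" "G \<subseteq> H" "H \<subseteq> E"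
    using fgmod_sup[OF F(1) G(1) F(2) G(2)] assms FbarD by blast
  then have "star F \<subseteq> star H" "star G \<subseteq> star H"
    using F G by (simp_all add: semistarD(3)[OF assms(1)] fgmod_Fbar)
  then have "insert a A \<subseteq> star H"
    using F G by blast
  with H show ?case by blast
qed

lemma finite_type_ext:
  assumes "semistar D star" "E \<in> Fbar D"
  shows "E \<subseteq> finite_type D star E"
proof
  fix x assume x: "x \<in> E"
  obtain e where e: "e \<in> E" "e \<noteq> 0"
    using Fbar_nonzero assms by blast
  \<comment> \<open>The extra generator \<open>e\<close> keeps the hull nonzero when
    \<open>x = 0\<close>.\<close>
  have F: "is_submodule D hull {e, x} \<in> fgmod D"
    using e by (auto intro: fgmodI)
  moreover have "x \<in> star (is_submodule D hull {e, x})"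
    using semistarD(4)[OF assms(1) fgmod_Fbar[OF F]] hull_inc[of x "{e, x}"] by blast
  moreover have "is_submodule D hull {e, x} \<subseteq> E"
    using e x assms by (simp add: hull_le_iff FbarD)
  ultimately show "x \<in> finite_type D star E"
    by (auto simp: mem_finite_type)
qed

lemma semistar_finite_type:
  assumes "semistar D star"
  shows "semistar D (finite_type D star)"
proof -
  let ?s = "finite_type D star"
  have Fbar: "?s E \<in> Fbar D" if E: "E \<in> Fbar D" for E
  proof -
    obtain e where e: "e \<in> E" "e \<noteq> 0"
      using Fbar_nonzero E by blast
    have sub: "is_submodule D (star F)" if "F \<in> fgmod D" for F
      using that by (intro FbarD semistarD(1)[OF assms] fgmod_Fbar)
    have "is_submodule D (?s E)"
      unfolding is_submodule_def
    proof (intro conjI ballI)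
      show "0 \<in> ?s E"
        using finite_type_ext[OF assms E] submoduleD(1)[OF FbarD[OF E]] by blast
    next
      fix x y assume "x \<in> ?s E" "y \<in> ?s E"
      then obtain F where "F \<in> fgmod D" "F \<subseteq> E" "x \<in> star F" "y \<in> star F"
        using finite_type_finite_subset[OF assms E, of "{x, y}"] by auto
      then show "x + y \<in> ?s E"
        using submoduleD(2)[OF sub] unfolding mem_finite_type by blast
    next
      fix d x assume "d \<in> D" "x \<in> ?s E"
      then show "d * x \<in> ?s E"
        using submoduleD(3)[OF sub] unfolding mem_finite_type by blast
    qed
    then show ?thesis
      using e finite_type_ext[OF assms E] by (blast intro: FbarI)
  qed
  have scale_le: "(*) x ` ?s E \<subseteq> ?s ((*) x ` E)" if "E \<in> Fbar D" "x \<noteq> 0" for E x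
  proof
    fix z assume "z \<in> (*) x ` ?s E"
    then obtain F where F: "F \<in> fgmod D" "F \<subseteq> E" "z \<in> (*) x ` star F"
      unfolding finite_type_def by blast
    then have "z \<in> star ((*) x ` F)"
      using that by (simp add: semistarD(2)[OF assms] fgmod_Fbar)
    then show "z \<in> ?s ((*) x ` E)"
      using F that fgmod_scale[of F D x] image_mono[of F E "(*) x"]
      unfolding mem_finite_type by blast
  qed
  have scale: "?s ((*) x ` E) = (*) x ` ?s E" if E: "E \<in> Fbar D" "x \<noteq> 0" for E x
  proof
    show "(*) x ` ?s E \<subseteq> ?s ((*) x ` E)"
      using scale_le that .
    \<comment> \<open>The reverse inclusion is \<open>scale_le\<close> for the module
      \<open>x E\<close> and the factor \<open>1 / x\<close>.\<close>
    have "(*) (1 / x) ` ?s ((*) x ` E) \<subseteq> ?s ((*) (1 / x) ` (*) x ` E)"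
      using that by (intro scale_le Fbar_scale) auto
    also have "(*) (1 / x) ` (*) x ` E = E"
      using that by (simp add: image_image)
    finally show "?s ((*) x ` E) \<subseteq> (*) x ` ?s E"
      using that by (force simp: image_iff)
  qed
  \<comment> \<open>The finitely many generators of \<open>F\<close> lie in one
    \<open>star G\<close> with \<open>G\<close> inside \<open>E\<close>; hence so does
    \<open>F\<close>, and idempotence of \<open>star\<close> applies to \<open>G\<close>.\<close>
  have idem: "?s (?s E) \<subseteq> ?s E" if E: "E \<in> Fbar D" for E
  proof
    fix x assume "x \<in> ?s (?s E)"
    then obtain F where F: "F \<in> fgmod D" "F \<subseteq> ?s E" "x \<in> star F"
      by (auto simp: mem_finite_type)
    obtain S where S: "finite S" "F = is_submodule D hull S"
      using F(1) by (rule fgmodE)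
    then have "S \<subseteq> ?s E"
      using F(2) hull_subset order_trans by metis
    with S obtain G where G: "G \<in> fgmod D" "G \<subseteq> E" "S \<subseteq> star G"
      using finite_type_finite_subset[OF assms E, of S] by blast
    then have "F \<subseteq> star G"
      unfolding S using assms by (simp add: hull_le_iff semistarD(1) fgmod_Fbar FbarD)
    then have "star F \<subseteq> star G"
      using F G assms by (intro star_le_star[OF assms]) (auto simp: fgmod_Fbar)
    with F G show "x \<in> ?s E"
      by (auto simp: mem_finite_type)
  qed
  show ?thesis
    unfolding semistar_def
  proof (intro conjI ballI allI impI)
    fix E assume E: "E \<in> Fbar D"
    then show "?s (?s E) = ?s E"
      using idem finite_type_ext[OF assms Fbar] by blast
  qed (simp_all add: Fbar scale finite_type_mono finite_type_ext[OF assms])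
qed

section \<open>Quasi-ideals and quasi-maximal ideals\<close>

lemma quasi_ideal_Fbar: "quasi_ideal D s I \<Longrightarrow> I \<in> Fbar D"
  by (auto simp: quasi_ideal_def is_ideal_def Fbar_def)

lemma ideal_one:
  assumes "is_ideal D I" "1 \<in> I"
  shows "I = D"
  using assms submoduleD(3)[of D I _ 1] by (auto simp: is_ideal_def)

lemma quasi_ideal_one_notin:
  assumes "is_subring D" "quasi_ideal D s I" "I \<noteq> D"
  shows "1 \<notin> s I"
  using assms(2,3) ideal_one[of D I] subringD(1)[OF assms(1)] unfolding quasi_ideal_def by blast

lemma finite_subset_Union_chain:
  assumes "finite S" "S \<subseteq> \<Union>C" "C \<noteq> {}" "\<And>A B. A \<in> C \<Longrightarrow> B \<in> C \<Longrightarrow> A \<subseteq> B \<or> B \<subseteq> A"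
  shows "\<exists>A\<in>C. S \<subseteq> A"
  using assms(1,2)
proof induction
  case empty
  then show ?case using assms by blast
next
  case (insert x S)
  then obtain A B where "A \<in> C" "S \<subseteq> A" "B \<in> C" "x \<in> B" by auto
  then show ?case
    using assms(4)[of A B] by blast
qed

text \<open>Zorn's lemma is applied to all ideals above \<open>I\<close> whose closure omits 1.
  Finite type keeps unions of chains in this family, and a maximal member turns out to be a
  quasi-ideal.\<close>

lemma QMax_exists:
  assumes D: "is_subring D" and star: "semistar D star" and I: "is_ideal D I" "I \<noteq> {0}"
    and one: "1 \<notin> finite_type D star I"
  shows "\<exists>M\<in>QMax D (finite_type D star). I \<subseteq> M"
proof -
  let ?s = "finite_type D star"
  let ?A = "{J. is_ideal D J \<and> I \<subseteq> J \<and> 1 \<notin> ?s J}"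
  have s: "semistar D ?s" using star by (rule semistar_finite_type)
  have nz: "J \<noteq> {0}" if "I \<subseteq> J" for J
    using that I by (auto simp: is_ideal_def is_submodule_def)
  have Fbar: "J \<in> Fbar D" if "J \<in> ?A" for J
    using that nz[of J] by (auto simp: Fbar_def is_ideal_def)
  have "\<exists>J\<in>?A. \<forall>X\<in>?A. J \<subseteq> X \<longrightarrow> X = J"
  proof (rule subset_Zorn)
    fix C assume chain: "subset.chain ?A C"
    show "\<exists>U\<in>?A. \<forall>X\<in>C. X \<subseteq> U"
    proof (cases "C = {}")
      case True
      then show ?thesis using I one by auto
    next
      case False
      have C: "\<And>A B. A \<in> C \<Longrightarrow> B \<in> C \<Longrightarrow> A \<subseteq> B \<or> B \<subseteq> A" "C \<subseteq> ?A"
        using chain unfolding subset.chain_def by blast+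
      have sub: "is_submodule D J" if "J \<in> C" for J
        using that C(2) by (auto simp: is_ideal_def)
      have "is_submodule D (\<Union>C)"
        unfolding is_submodule_def
      proof (intro conjI ballI)
        show "0 \<in> \<Union>C"
          using False sub submoduleD(1) by blast
      next
        fix x y assume "x \<in> \<Union>C" "y \<in> \<Union>C"
        then obtain J where "J \<in> C" "{x, y} \<subseteq> J"
          using finite_subset_Union_chain[of "{x, y}" C] C(1) False by auto
        then show "x + y \<in> \<Union>C"
          using submoduleD(2)[OF sub] by blast
      next
        fix d x assume "d \<in> D" "x \<in> \<Union>C"
        then show "d * x \<in> \<Union>C"
          using submoduleD(3)[OF sub] by blast
      qed
      moreover have "\<Union>C \<subseteq> D" "I \<subseteq> \<Union>C"
        using C(2) False by (auto simp: is_ideal_def)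
      \<comment> \<open>A finitely generated \<open>F\<close> witnessing 1 in the closure would
        already be contained in one member of the chain.\<close>
      moreover have "1 \<notin> ?s (\<Union>C)"
      proof
        assume "1 \<in> ?s (\<Union>C)"
        then obtain F where F: "F \<in> fgmod D" "F \<subseteq> \<Union>C" "1 \<in> star F"
          by (auto simp: mem_finite_type)
        obtain S where S: "finite S" "F = is_submodule D hull S"
          using F(1) by (rule fgmodE)
        then have "S \<subseteq> \<Union>C"
          using F(2) hull_subset order_trans by metis
        then obtain J where J: "J \<in> C" "S \<subseteq> J"
          using finite_subset_Union_chain[OF S(1) _ False C(1)] by blast
        then have "F \<subseteq> J"
          using S sub by (simp add: hull_le_iff)
        with F J C(2) show False
          by (auto simp: mem_finite_type)
      qed
      ultimately have "\<Union>C \<in> ?A" by (simp add: is_ideal_def)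
      then show ?thesis by (rule bexI[rotated]) (rule ballI, rule Union_upper)
    qed
  qed
  then obtain J where J: "J \<in> ?A" and "\<forall>X\<in>?A. J \<subseteq> X \<longrightarrow> X = J"
    by (rule bexE)
  then have Jmax: "\<And>X. X \<in> ?A \<Longrightarrow> J \<subseteq> X \<Longrightarrow> X = J"
    by simp
  have ext: "J \<subseteq> ?s J \<inter> D"
    using semistarD(4)[OF s Fbar[OF J]] J by (auto simp: is_ideal_def)
  \<comment> \<open>The ideal \<open>?s J \<inter> D\<close> contains \<open>J\<close> and, by
    idempotence of \<open>?s\<close>, still belongs to the family; maximality makes it equal to
    \<open>J\<close>.\<close>
  have "is_ideal D (?s J \<inter> D)"
    using semistarD(1)[OF s Fbar[OF J]] D
    by (auto simp: is_ideal_def FbarD submodule_subring intro: submodule_Int)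
  moreover have "1 \<notin> ?s (?s J \<inter> D)"
    using finite_type_mono[of "?s J \<inter> D" "?s J" D star] semistarD(5)[OF s Fbar[OF J]] J by auto
  ultimately have "?s J \<inter> D = J"
    using J ext by (intro Jmax) auto
  then have q: "quasi_ideal D ?s J"
    using J nz by (auto simp: quasi_ideal_def)
  have "J \<noteq> D"
    using J semistarD(4)[OF s Fbar_subring[OF D]] D by (auto simp: subringD)
  moreover have "X = J" if X: "quasi_ideal D ?s X" "X \<noteq> D" "J \<subseteq> X" for X
    using quasi_ideal_one_notin[OF D X(1,2)] X J by (intro Jmax) (auto simp: quasi_ideal_def)
  ultimately have "J \<in> QMax D ?s"
    using q by (simp add: QMax_def)
  with J show ?thesis by blast
qed

lemma QMax_quasi_ideal: "M \<in> QMax D s \<Longrightarrow> quasi_ideal D s M"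
  by (auto simp: QMax_def)

text \<open>Let \<open>ab\<close> be in \<open>M\<close> and \<open>a\<close> outside
  \<open>M\<close>. By maximality the closure of \<open>J = M + aD\<close> contains 1. Multiplying
  by \<open>b\<close> puts \<open>b\<close> in the closure of \<open>bJ\<close>, which lies inside
  \<open>M\<close>, so \<open>b\<close> belongs to \<open>M\<close>.\<close>

lemma QMax_prime:
  assumes D: "is_subring D" and star: "semistar D star" and M: "M \<in> QMax D (finite_type D star)"
  shows "is_prime_ideal D M"
proof -
  let ?s = "finite_type D star"
  have s: "semistar D ?s" using star by (rule semistar_finite_type)
  have q: "quasi_ideal D ?s M" and ne: "M \<noteq> D" and id: "is_ideal D M"
    using M by (auto simp: QMax_def quasi_ideal_def)
  have subM: "is_submodule D M" "M \<subseteq> D"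
    using id by (auto simp: is_ideal_def)
  have "b \<in> M" if ab: "a \<in> D" "b \<in> D" "a * b \<in> M" and a: "a \<notin> M" for a b
  \<comment> \<open>The law for scaling by \<open>b\<close> requires \<open>b\<close> to be
    nonzero.\<close>
  proof (cases "b = 0")
    case True
    then show ?thesis using subM submoduleD(1) by blast
  next
    case False
    let ?J = "{m + d * a | m d. m \<in> M \<and> d \<in> D}"
    have sub: "is_submodule D ?J"
      unfolding is_submodule_def
    proof (intro conjI ballI)
      show "0 \<in> ?J"
        using submoduleD(1)[OF subM(1)] subringD(2)[OF D] by force
    next
      fix x y assume "x \<in> ?J" "y \<in> ?J"
      then obtain m d n e where "x = m + d * a" "y = n + e * a" "m \<in> M" "n \<in> M" "d \<in> D" "e \<in> D"
        by blast
      then have "x + y = (m + n) + (d + e) * a" "m + n \<in> M" "d + e \<in> D"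
        using D subM submoduleD(2) by (auto simp: algebra_simps subringD)
      then show "x + y \<in> ?J" by blast
    next
      fix c x assume c: "c \<in> D" and "x \<in> ?J"
      then obtain m d where "x = m + d * a" "m \<in> M" "d \<in> D"
        by blast
      then have "c * x = c * m + (c * d) * a" "c * m \<in> M" "c * d \<in> D"
        using c D subM submoduleD(3) by (auto simp: algebra_simps subringD)
      then show "c * x \<in> ?J" by blast
    qed
    have MJ: "M \<subseteq> ?J"
    proof
      fix m assume "m \<in> M"
      then have "m = m + 0 * a" "0 \<in> D" using D by (auto simp: subringD)
      then show "m \<in> ?J" using \<open>m \<in> M\<close> by blast
    qed
    have "a = 0 + 1 * a" by simp
    then have aJ: "a \<in> ?J"
      using submoduleD(1)[OF subM(1)] subringD(1)[OF D] by blast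
    have JD: "?J \<subseteq> D"
      using subM ab D by (auto intro!: subringD)
    have "a \<noteq> 0"
      using a submoduleD(1)[OF subM(1)] by metis
    then have "?J \<noteq> {0}"
      using aJ by (metis singletonD)
    have one: "1 \<in> ?s ?J"
    proof (rule ccontr)
      assume "1 \<notin> ?s ?J"
      then obtain N where N: "N \<in> QMax D ?s" "?J \<subseteq> N"
        using QMax_exists[OF D star, of ?J] sub JD \<open>?J \<noteq> {0}\<close> by (auto simp: is_ideal_def)
      then have "N = M"
        using M MJ by (auto simp: QMax_def)
      with N aJ a show False by blast
    qed
    have JF: "?J \<in> Fbar D"
      using sub \<open>?J \<noteq> {0}\<close> by (simp add: Fbar_def)
    have "b \<in> (*) b ` ?s ?J"
      using one by force
    also have "\<dots> = ?s ((*) b ` ?J)"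
      using semistarD(2)[OF s JF False] by simp
    also have "\<dots> \<subseteq> ?s M"
    proof (intro finite_type_mono image_subsetI)
      fix x assume "x \<in> ?J"
      then obtain m d where x: "x = m + d * a" "m \<in> M" "d \<in> D" by blast
      have "b * x = b * m + d * (a * b)" using x by (simp add: algebra_simps)
      then show "b * x \<in> M"
        using x ab subM by (simp add: submoduleD)
    qed
    finally show ?thesis
      using q ab by (auto simp: quasi_ideal_def)
  qed
  then show ?thesis
    using id ne by (auto simp: is_prime_ideal_def)
qed

lemma QMax_QSpec:
  "is_subring D \<Longrightarrow> semistar D star \<Longrightarrow> M \<in> QMax D (finite_type D star) \<Longrightarrow>
    M \<in> QSpec D (finite_type D star)"
  by (simp add: QSpec_def QMax_prime QMax_quasi_ideal)

section \<open>Localizations\<close>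

lemma localizationI: "a \<in> D \<Longrightarrow> c \<in> D \<Longrightarrow> c \<notin> P \<Longrightarrow> a / c \<in> localization D P"
  by (auto simp: localization_def)

lemma localizationE:
  assumes "x \<in> localization D P"
  obtains a c where "a \<in> D" "c \<in> D" "c \<notin> P" "x = a / c"
  using assms by (auto simp: localization_def)

lemma prime_zero: "is_prime_ideal D P \<Longrightarrow> 0 \<in> P"
  by (simp add: is_prime_ideal_def is_ideal_def is_submodule_def)

lemma prime_one: "is_prime_ideal D P \<Longrightarrow> 1 \<notin> P"
  using ideal_one[of D P] by (auto simp: is_prime_ideal_def)

lemma prime_sub: "is_prime_ideal D P \<Longrightarrow> P \<subseteq> D"
  by (simp add: is_prime_ideal_def is_ideal_def)

lemma prime_mult: "is_prime_ideal D P \<Longrightarrow> a \<in> D \<Longrightarrow> p \<in> P \<Longrightarrow> a * p \<in> P"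
  by (simp add: is_prime_ideal_def is_ideal_def is_submodule_def)

lemma prime_cases: "is_prime_ideal D P \<Longrightarrow> a * b \<in> P \<Longrightarrow> a \<in> D \<Longrightarrow> b \<in> D \<Longrightarrow> a \<in> P \<or> b \<in> P"
  by (simp add: is_prime_ideal_def)

lemma localization_inc: "is_subring D \<Longrightarrow> is_prime_ideal D P \<Longrightarrow> D \<subseteq> localization D P"
  using localizationI[of _ D 1 P] by (auto simp: subringD prime_one)

lemma localization_antimono: "P \<subseteq> Q \<Longrightarrow> localization D Q \<subseteq> localization D P"
  by (auto simp: localization_def)

lemma localization_mult:
  assumes "is_subring D" "is_prime_ideal D P" "x \<in> localization D P" "y \<in> localization D P"
  shows "x * y \<in> localization D P"
proof -
  obtain a c where "a \<in> D" "c \<in> D" "c \<notin> P" "x = a / c"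
    using assms(3) by (rule localizationE)
  moreover obtain b d where "b \<in> D" "d \<in> D" "d \<notin> P" "y = b / d"
    using assms(4) by (rule localizationE)
  ultimately show ?thesis
    using assms localizationI[of "a * b" D "c * d" P] prime_cases[OF assms(2), of c d]
    by (auto simp: subringD)
qed

lemma subring_localization:
  assumes D: "is_subring D" and P: "is_prime_ideal D P"
  shows "is_subring (localization D P)"
  unfolding is_subring_def
proof (intro conjI ballI)
  show "1 \<in> localization D P"
    using localization_inc assms subringD(1) by blast
next
  fix x y assume x: "x \<in> localization D P" and y: "y \<in> localization D P"
  then show "x * y \<in> localization D P"
    by (rule localization_mult[OF assms])
  obtain a c where x: "a \<in> D" "c \<in> D" "c \<notin> P" "x = a / c"
    using x by (rule localizationE)
  obtain b d where y: "b \<in> D" "d \<in> D" "d \<notin> P" "y = b / d"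
    using y by (rule localizationE)
  have "x - y = (a * d - b * c) / (c * d)"
    using x y prime_zero[OF P] by (subst x(4), subst y(4), subst diff_frac_eq) auto
  then show "x - y \<in> localization D P"
    using x y D prime_cases[OF P, of c d] by (auto intro!: localizationI subringD)
qed

section \<open>P\<star>MDs\<close>

text \<open>Otherwise the product of \<open>G\<close> and its inverse lies in \<open>Q\<close>, and
  the closure of \<open>Q\<close> contains \<open>star D\<close> and hence 1. The lemma expresses
  invertibility of \<open>G\<close> at \<open>Q\<close> through one pair of elements.\<close>

lemma PstarMD_not_in_QSpec:
  assumes D: "domain_with_quotient_field D" and star: "semistar D star" and pmd: "PstarMD D star"
    and Q: "Q \<in> QSpec D (finite_type D star)" and G: "G \<in> fgmod D"
  shows "\<exists>g\<in>G. \<exists>u\<in>colon D G. g * u \<notin> Q"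
proof (rule ccontr)
  let ?s = "finite_type D star"
  assume "\<not> ?thesis"
  then have "mod_mult G (colon D G) \<subseteq> Q"
    using Q by (intro mod_mult_le[of D]) (auto simp: QSpec_def is_prime_ideal_def is_ideal_def)
  then have "star D \<subseteq> ?s Q"
    using pmd G finite_type_mono by (metis PstarMD_def)
  moreover have "is_subring D" using D by (simp add: domain_with_quotient_field_def)
  ultimately have "1 \<in> ?s Q"
    using semistarD(4)[OF star Fbar_subring] subringD(1) by blast
  then show False
    using quasi_ideal_one_notin[of D ?s Q] Q \<open>is_subring D\<close>
    by (auto simp: QSpec_def is_prime_ideal_def)
qed

text \<open>Apply the preceding lemma to the module generated by 1 and \<open>x\<close>. It yields
  \<open>u\<close> with \<open>u\<close> and \<open>ux\<close> in \<open>D\<close>, not both in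
  \<open>Q\<close>; then \<open>x = ux / u\<close> or \<open>1 / x = u / ux\<close> has its
  denominator outside \<open>Q\<close>.\<close>

lemma QSpec_valuation:
  assumes D: "domain_with_quotient_field D" and star: "semistar D star" and pmd: "PstarMD D star"
    and Q: "Q \<in> QSpec D (finite_type D star)" and x: "x \<noteq> 0"
  shows "x \<in> localization D Q \<or> 1 / x \<in> localization D Q"
proof -
  have sub: "is_submodule D Q"
    using Q by (auto simp: QSpec_def is_prime_ideal_def is_ideal_def)
  let ?G = "is_submodule D hull {1, x}"
  have "?G \<in> fgmod D" by (rule fgmodI[of _ 1]) auto
  then obtain g u where g: "g \<in> ?G" and u: "u \<in> colon D ?G" and gu: "g * u \<notin> Q"
    using PstarMD_not_in_QSpec[OF D star pmd Q] by blast
  have "1 \<in> ?G" "x \<in> ?G" by (auto intro: hull_inc)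
  then have uD: "u \<in> D" "u * x \<in> D"
    using u unfolding colon_def by force+
  have "\<not> (u \<in> Q \<and> u * x \<in> Q)"
  proof
    assume "u \<in> Q \<and> u * x \<in> Q"
    then have "?G \<subseteq> {y. u * y \<in> Q}"
      by (subst hull_le_iff) (auto intro: submodule_unscale sub)
    with g gu show False by (auto simp: mult.commute)
  qed
  moreover have "x = (u * x) / u" if "u \<notin> Q"
    using that submoduleD(1)[OF sub] by auto
  moreover have "1 / x = u / (u * x)" if "u * x \<notin> Q"
    using that submoduleD(1)[OF sub] by auto
  ultimately show ?thesis
    using uD localizationI by metis
qed

text \<open>Suppose \<open>x\<close> in \<open>D\<close> lies in the closure of \<open>P\<close> but
  not in \<open>P\<close>, with witness \<open>F\<close>. Choose \<open>g\<close> in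
  \<open>F\<close> and \<open>u\<close> in its inverse with \<open>gu\<close> outside
  \<open>M\<close>, and compare \<open>x\<close> with \<open>g\<close> in the valuation ring
  \<open>D_M\<close>. Divisibility of \<open>x\<close> by \<open>g\<close> puts \<open>x\<close>
  into \<open>P\<close>; the other case puts an element outside \<open>M\<close> into the closure of
  \<open>M\<close>.\<close>

lemma prime_le_QMax_QSpec:
  assumes D: "domain_with_quotient_field D" and star: "semistar D star" and pmd: "PstarMD D star"
    and M: "M \<in> QMax D (finite_type D star)" and P: "is_prime_ideal D P" "P \<noteq> {0}" "P \<subseteq> M"
  shows "P \<in> QSpec D (finite_type D star)"
proof -
  let ?s = "finite_type D star"
  have ring: "is_subring D" using D by (simp add: domain_with_quotient_field_def)
  have s: "semistar D ?s" using star by (rule semistar_finite_type)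
  have MQ: "M \<in> QSpec D ?s" using QMax_QSpec ring star M by blast
  then have Mp: "is_prime_ideal D M" by (simp add: QSpec_def)
  have PF: "P \<in> Fbar D"
    using P by (auto simp: is_prime_ideal_def is_ideal_def Fbar_def)
  have "x \<in> P" if xs: "x \<in> ?s P" and xD: "x \<in> D" for x
  proof (rule ccontr)
    assume xP: "x \<notin> P"
    then have x0: "x \<noteq> 0" using prime_zero[OF P(1)] by auto
    obtain F where F: "F \<in> fgmod D" "F \<subseteq> P" "x \<in> star F"
      using xs by (auto simp: mem_finite_type)
    obtain g u where g: "g \<in> F" and u: "u \<in> colon D F" and gu: "g * u \<notin> M"
      using PstarMD_not_in_QSpec[OF D star pmd MQ F(1)] by blast
    have g0: "g \<noteq> 0" using gu prime_zero[OF Mp] by auto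
    have gP: "g \<in> P" using g F by blast
    have uF: "u * f \<in> D" if "f \<in> F" for f using u that by (auto simp: colon_def)
    from QSpec_valuation[OF D star pmd MQ, of "x / g"]
    consider "x / g \<in> localization D M" | "g / x \<in> localization D M"
      using x0 g0 by auto
    then show False
    proof cases
      case 1
      then obtain a c where ac: "a \<in> D" "c \<in> D" "c \<notin> M" "x / g = a / c"
        by (rule localizationE)
      then have "c * x = a * g"
        using g0 prime_zero[OF Mp] by (auto simp: field_simps)
      then have "c * x \<in> P"
        using prime_mult[OF P(1)] ac gP by simp
      with ac xD xP P show False using prime_cases[OF P(1)] by blast
    next
      case 2
      then obtain a c where ac: "a \<in> D" "c \<in> D" "c \<notin> M" "g / x = a / c"
        by (rule localizationE)
      then have gc: "g * c = a * x"
        using x0 prime_zero[OF Mp] by (auto simp: field_simps)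
      have "c * g \<in> P"
        using prime_mult[OF P(1)] ac gP by simp
      \<comment> \<open>Here \<open>a x = g c\<close> lies in \<open>P\<close> while
        \<open>x\<close> does not, so primeness gives \<open>a\<close>.\<close>
      then have aP: "a \<in> P"
        using prime_cases[OF P(1), of a x] ac xD xP gc by (auto simp: mult.commute)
      have a0: "a \<noteq> 0" using gc g0 ac prime_zero[OF Mp] by auto
      \<comment> \<open>This element lies outside \<open>M\<close>, yet
        \<open>w f = x a (u f)\<close> for every \<open>f\<close> in \<open>F\<close>. Applying
        \<open>star\<close> to \<open>w F \<subseteq> x a D\<close>, using that \<open>x\<close> is
        in \<open>star F\<close> and cancelling \<open>x\<close>, puts \<open>w\<close> into
        \<open>star\<close> of \<open>aD\<close>.\<close>
      let ?w = "u * g * c"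
      have wD: "?w \<in> D" using ac g by (intro subringD[OF ring] uF)
      have wM: "?w \<notin> M"
        using prime_cases[OF Mp, of "u * g" c] gu ac uF[OF g] by (auto simp: mult.commute)
      have w0: "?w \<noteq> 0" using wM prime_zero[OF Mp] by auto
      have aD: "(*) a ` D \<in> fgmod D" using ring a0 by (rule fgmod_principal)
      have "(*) ?w ` F \<subseteq> (*) x ` (*) a ` D"
      proof (rule image_subsetI)
        fix f assume "f \<in> F"
        have "?w * f = x * (a * (u * f))"
          using gc by (metis (no_types, lifting) mult.assoc mult.commute)
        then show "?w * f \<in> (*) x ` (*) a ` D"
          using uF[OF \<open>f \<in> F\<close>] by blast
      qed
      then have "star ((*) ?w ` F) \<subseteq> star ((*) x ` (*) a ` D)"
        using F(1) w0 x0 aD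
        by (intro semistarD(3)[OF star] fgmod_Fbar fgmod_scale[of F] fgmod_scale[of "(*) a ` D"])
      then have "(*) ?w ` star F \<subseteq> (*) x ` star ((*) a ` D)"
        using F w0 x0 aD by (simp add: semistarD(2)[OF star] fgmod_Fbar)
      then have "?w * x \<in> (*) x ` star ((*) a ` D)"
        using F(3) by blast
      then have "?w \<in> star ((*) a ` D)"
        using x0 by (auto simp: mult.commute)
      moreover have "(*) a ` D \<subseteq> M"
        using aP P prime_mult[OF Mp] by (auto simp: mult.commute)
      ultimately have "?w \<in> ?s M"
        using aD by (auto simp: mem_finite_type)
      then show False
        using wD wM MQ by (auto simp: QSpec_def quasi_ideal_def)
    qed
  qed
  then have "?s P \<inter> D = P"
    using semistarD(4)[OF s PF] prime_sub[OF P(1)] by auto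
  then show ?thesis
    using P by (auto simp: QSpec_def quasi_ideal_def is_prime_ideal_def)
qed

text \<open>Given elements \<open>a\<close> and \<open>b\<close> separating the two primes, the
  valuation ring \<open>D_Q\<close> contains \<open>b / a\<close> or \<open>a / b\<close>. Clearing
  the denominator, which lies outside \<open>Q\<close>, contradicts primeness.\<close>

lemma primes_below_QSpec_comparable:
  assumes D: "domain_with_quotient_field D" and star: "semistar D star" and pmd: "PstarMD D star"
    and Q: "Q \<in> QSpec D (finite_type D star)"
    and P: "is_prime_ideal D P" "P \<subseteq> Q" and P': "is_prime_ideal D P'" "P' \<subseteq> Q"
  shows "P \<subseteq> P' \<or> P' \<subseteq> P"
proof (rule ccontr)
  \<comment> \<open>Stated for arbitrary \<open>A\<close> and \<open>B\<close>, so that exchanging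
    the two primes covers both quotients.\<close>
  have False if A: "is_prime_ideal D A" "A \<subseteq> Q" and B: "is_prime_ideal D B"
    and a: "a \<in> A" "a \<notin> B" and b: "b \<in> B" "b \<notin> A" and loc: "b / a \<in> localization D Q" for A B a b
  proof -
    obtain d c where dc: "d \<in> D" "c \<in> D" "c \<notin> Q" "b / a = d / c"
      using loc by (rule localizationE)
    have "a \<noteq> 0" "c \<noteq> 0"
      using prime_zero B A a dc by blast+
    then have "b * c = d * a"
      using dc by (simp add: field_simps)
    then have "b * c \<in> A"
      using prime_mult[OF A(1)] dc a by simp
    then show False
      using prime_cases[OF A(1)] b dc A prime_sub[OF B] by blast
  qed
  note * = this
  assume "\<not> ?thesis"
  then obtain a b where ab: "a \<in> P" "a \<notin> P'" "b \<in> P'" "b \<notin> P" by blast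
  then have "b / a \<noteq> 0"
    using prime_zero P P' by force
  then have "b / a \<in> localization D Q \<or> a / b \<in> localization D Q"
    using QSpec_valuation[OF D star pmd Q, of "b / a"] by simp
  then show False
    using *[OF P P'(1)] *[OF P' P(1)] ab by blast
qed

section \<open>Linked overrings\<close>

text \<open>If the closure of \<open>N \<inter> D\<close> contained 1, some finitely generated
  \<open>F\<close> inside it would satisfy \<open>star F = star D\<close>. Linkedness would then put
  1 into the closure of \<open>FT\<close>, hence of \<open>N\<close>. So \<open>N \<inter> D\<close>
  lies below a quasi-maximal ideal, and in a P\<open>star\<close>MD this makes it a
  quasi-ideal.\<close>

lemma linked_contraction_QSpec:
  assumes D: "domain_with_quotient_field D" and star: "semistar D star" and pmd: "PstarMD D star"
    and T: "overring D T" and star': "semistar T star'" and link: "linked D star T star'"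
    and N: "N \<in> QMax T (finite_type T star')"
  shows "N \<inter> D \<in> QSpec D (finite_type D star)"
    and "\<exists>M\<in>QMax D (finite_type D star). N \<inter> D \<subseteq> M"
proof -
  have ring: "is_subring D" using D by (simp add: domain_with_quotient_field_def)
  have ringT: "is_subring T" and DT: "D \<subseteq> T" using T by (auto simp: overring_def)
  have Np: "is_prime_ideal T N" using QMax_prime[OF ringT star' N] .
  have Nq: "quasi_ideal T (finite_type T star') N" "N \<noteq> T" using N by (auto simp: QMax_def)
  have subN: "is_submodule T N" using Np by (auto simp: is_prime_ideal_def is_ideal_def)
  have id: "is_ideal D (N \<inter> D)"
    using submodule_restrict[OF subN DT] submodule_subring[OF ring]
    by (simp add: is_ideal_def submodule_Int)
  have prime: "is_prime_ideal D (N \<inter> D)"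
    using id prime_one[OF Np] subringD(1)[OF ring] prime_cases[OF Np] DT
    unfolding is_prime_ideal_def by blast
  \<comment> \<open>The numerator of a nonzero fraction in \<open>N\<close> is a nonzero element of
    \<open>N \<inter> D\<close>.\<close>
  obtain n where n: "n \<in> N" "n \<noteq> 0"
    using Fbar_nonzero[OF quasi_ideal_Fbar[OF Nq(1)]] by blast
  obtain a b where ab: "a \<in> D" "b \<in> D" "b \<noteq> 0" "n = a / b"
    using D unfolding domain_with_quotient_field_def by blast
  then have "a = b * n" by simp
  then have "a \<in> N \<inter> D" "a \<noteq> 0"
    using ab(1-3) n DT submoduleD(3)[OF subN, of b n] by auto
  then have nz: "N \<inter> D \<noteq> {0}" by blast
  have "1 \<notin> finite_type D star (N \<inter> D)"
  proof
    assume "1 \<in> finite_type D star (N \<inter> D)"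
    then obtain F where F: "F \<in> fgmod D" "F \<subseteq> N \<inter> D" "1 \<in> star F"
      by (auto simp: mem_finite_type)
    have "star F = star D"
      using F by (intro star_eq_if_one[OF ring star]) (auto simp: fgmod_Fbar)
    then have "star' (mod_mult F T) = star' T"
      using link F by (auto simp: linked_def)
    then have "1 \<in> star' (mod_mult F T)"
      using semistarD(4)[OF star' Fbar_subring[OF ringT]] subringD(1)[OF ringT] by auto
    moreover have "mod_mult F T \<subseteq> N"
      using F by (intro mod_mult_overring_le[OF DT subN]) auto
    ultimately have "1 \<in> finite_type T star' N"
      using fgmod_mod_mult[OF T F(1)] by (auto simp: mem_finite_type)
    then show False
      using quasi_ideal_one_notin[OF ringT Nq] by blast
  qed
  then show M: "\<exists>M\<in>QMax D (finite_type D star). N \<inter> D \<subseteq> M"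
    by (intro QMax_exists ring star id nz)
  then show "N \<inter> D \<in> QSpec D (finite_type D star)"
    using prime_le_QMax_QSpec[OF D star pmd _ prime nz] by blast
qed

text \<open>A valuation ring is dominated by no overring other than itself.\<close>

lemma localization_contraction:
  assumes D: "domain_with_quotient_field D" and star: "semistar D star" and pmd: "PstarMD D star"
    and T: "overring D T" and N: "is_prime_ideal T N"
    and P: "N \<inter> D \<in> QSpec D (finite_type D star)"
  shows "localization T N = localization D (N \<inter> D)"
proof
  have ring: "is_subring D" using D by (simp add: domain_with_quotient_field_def)
  have ringT: "is_subring T" and DT: "D \<subseteq> T" using T by (auto simp: overring_def)
  have Pp: "is_prime_ideal D (N \<inter> D)" using P by (simp add: QSpec_def)
  \<comment> \<open>If the valuation ring omits \<open>1 / t\<close>, it contains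
    \<open>t = a / c\<close>. Then \<open>a = t c\<close> is outside \<open>N\<close>, so
    \<open>1 / t = c / a\<close> is in the ring after all.\<close>
  have inv: "1 / t \<in> localization D (N \<inter> D)" if t: "t \<in> T" "t \<notin> N" for t
  proof (rule ccontr)
    have t0: "t \<noteq> 0" using prime_zero[OF N] t by auto
    assume nin: "1 / t \<notin> localization D (N \<inter> D)"
    with QSpec_valuation[OF D star pmd P t0] have "t \<in> localization D (N \<inter> D)" by blast
    then obtain a c where ac: "a \<in> D" "c \<in> D" "c \<notin> N \<inter> D" "t = a / c"
      by (rule localizationE)
    then have "c \<noteq> 0" using prime_zero[OF Pp] by auto
    then have "t * c = a" using ac by simp
    then have "a \<notin> N"
      using prime_cases[OF N, of t c] t ac DT by auto
    then have "c / a \<in> localization D (N \<inter> D)" using ac by (auto intro: localizationI)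
    with ac nin show False by simp
  qed
  \<comment> \<open>Same argument for \<open>t\<close>: now \<open>1 / t = a / c\<close>, and
    \<open>c = t a\<close> outside \<open>N\<close> forces \<open>a\<close> outside
    \<open>N\<close>.\<close>
  have inc: "t \<in> localization D (N \<inter> D)" if t: "t \<in> T" for t
  proof (rule ccontr)
    assume nin: "t \<notin> localization D (N \<inter> D)"
    then have t0: "t \<noteq> 0"
      using localization_inc[OF ring Pp] subringD(2)[OF ring] by blast
    with QSpec_valuation[OF D star pmd P t0] nin have "1 / t \<in> localization D (N \<inter> D)" by blast
    then obtain a c where ac: "a \<in> D" "c \<in> D" "c \<notin> N \<inter> D" "1 / t = a / c"
      by (rule localizationE)
    then have "c \<noteq> 0" using prime_zero[OF Pp] by auto
    then have "t * a = c" using ac t0 by (simp add: field_simps)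
    then have "a \<notin> N"
      using prime_mult[OF N, of t a] t ac by auto
    then have "c / a \<in> localization D (N \<inter> D)" using ac by (auto intro: localizationI)
    moreover have "t = c / a" using \<open>t * a = c\<close> \<open>c \<noteq> 0\<close> by auto
    ultimately show False using nin by simp
  qed
  show "localization T N \<subseteq> localization D (N \<inter> D)"
  proof
    fix x assume "x \<in> localization T N"
    then obtain a c where "a \<in> T" "c \<in> T" "c \<notin> N" "x = a / c"
      by (rule localizationE)
    then show "x \<in> localization D (N \<inter> D)"
      using localization_mult[OF ring Pp inc inv, of a c] by simp
  qed
  show "localization D (N \<inter> D) \<subseteq> localization T N"
    using DT by (auto simp: localization_def)
qed

section \<open>From doublesharpness to sharp linked overrings\<close>

text \<open>An element of \<open>N'\<close> outside \<open>N\<close> is invertible in the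
  localization at \<open>N\<close>, but its inverse cannot lie in the localization at
  \<open>N'\<close>.\<close>

lemma prime_le_if_localization_le:
  assumes "is_subring T" "is_prime_ideal T N" "is_prime_ideal T N'"
    and "localization T N \<subseteq> localization T N'"
  shows "N' \<subseteq> N"
proof
  fix n assume n: "n \<in> N'"
  show "n \<in> N"
  proof (rule ccontr)
    assume nN: "n \<notin> N"
    have nT: "n \<in> T" using n prime_sub assms by blast
    have n0: "n \<noteq> 0" using nN prime_zero assms by blast
    have "1 / n \<in> localization T N'"
      using assms nT nN subringD(1) localizationI by blast
    then obtain a c where ac: "a \<in> T" "c \<in> T" "c \<notin> N'" "1 / n = a / c"
      by (rule localizationE)
    then have "c = a * n"
      using n0 prime_zero[OF assms(3)] by (auto simp: field_simps)
    with ac n prime_mult[OF assms(3)] show False by auto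
  qed
qed

text \<open>Passing from \<open>N \<inter> D\<close> to \<open>N\<close> leaves the localization
  unchanged and can only enlarge \<open>Theta\<close>, so sharpness is inherited.\<close>

lemma doublesharp_imp_linked_sharp:
  assumes D: "domain_with_quotient_field D" and star: "semistar D star" and pmd: "PstarMD D star"
    and ds: "doublesharp_domain D (finite_type D star)"
    and T: "overring D T" and star': "semistar T star'" and link: "linked D star T star'"
  shows "sharp_domain T (finite_type T star')"
  unfolding sharp_domain_def
proof
  let ?s = "finite_type D star" and ?s' = "finite_type T star'"
  have ringT: "is_subring T" using T by (auto simp: overring_def)
  note con = linked_contraction_QSpec[OF D star pmd T star' link]
  have prime: "is_prime_ideal T N" if "N \<in> QMax T ?s'" for N
    using QMax_prime[OF ringT star' that] .
  have loc: "localization T N = localization D (N \<inter> D)" if "N \<in> QMax T ?s'" for N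
    using localization_contraction[OF D star pmd T prime con(1)] that by blast
  \<comment> \<open>Localizations of \<open>T\<close> depend only on contractions and reverse
    inclusion; hence \<open>B\<close> is contained in \<open>A\<close>, and maximality of
    \<open>B\<close> gives equality.\<close>
  have anti: "B = A" if AB: "A \<in> QMax T ?s'" "B \<in> QMax T ?s'" "B \<inter> D \<subseteq> A \<inter> D" for A B
  proof -
    have "localization T A \<subseteq> localization T B"
      using loc AB localization_antimono by metis
    then have "B \<subseteq> A"
      using prime_le_if_localization_le[OF ringT prime prime] AB by blast
    then show ?thesis
      using AB by (auto simp: QMax_def)
  qed
  fix N assume N: "N \<in> QMax T ?s'"
  let ?P = "N \<inter> D"
  have "Theta D ?s ?P \<subseteq> Theta T ?s' N"
    unfolding Theta_def
  proof (rule INT_greatest)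
    fix N' assume "N' \<in> nabla T ?s' N"
    then have N': "N' \<in> QMax T ?s'" "N' \<noteq> N" by (auto simp: nabla_def)
    obtain M where M: "M \<in> QMax D ?s" "N' \<inter> D \<subseteq> M" using con(2)[OF N'(1)] by blast
    \<comment> \<open>Otherwise both contractions lie below \<open>M\<close> and are comparable,
      which \<open>anti\<close> excludes for distinct \<open>N\<close> and
      \<open>N'\<close>.\<close>
    have "\<not> ?P \<subseteq> M"
    proof
      assume "?P \<subseteq> M"
      moreover have "M \<in> QSpec D ?s"
        using QMax_QSpec D star M by (auto simp: domain_with_quotient_field_def)
      ultimately have "?P \<subseteq> N' \<inter> D \<or> N' \<inter> D \<subseteq> ?P"
        using primes_below_QSpec_comparable[OF D star pmd, of M ?P "N' \<inter> D"] M con(1)[OF N]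
          con(1)[OF N'(1)] by (auto simp: QSpec_def)
      then show False
        using anti[OF N N'(1)] anti[OF N'(1) N] N' by auto
    qed
    then have "M \<in> nabla D ?s ?P"
      using M by (simp add: nabla_def)
    then have "(\<Inter>M\<in>nabla D ?s ?P. localization D M) \<subseteq> localization D M" by blast
    also have "\<dots> \<subseteq> localization T N'"
      unfolding loc[OF N'(1)] using M localization_antimono by blast
    finally show "(\<Inter>M\<in>nabla D ?s ?P. localization D M) \<subseteq> localization T N'" .
  qed
  then show "sharp_prime T ?s' N"
    using ds con(1)[OF N] loc[OF N] unfolding doublesharp_domain_def sharp_prime_def by blast
qed

section \<open>The t-operation of an overring\<close>

lemma colon_antimono: "E \<subseteq> F \<Longrightarrow> colon T F \<subseteq> colon T E"
  by (auto simp: colon_def)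

lemma v_op_ext: "E \<subseteq> v_op T E"
  by (auto simp: v_op_def colon_def mult.commute)

text \<open>The map \<open>colon T\<close> forms a Galois connection with itself, so applying it
  three times is the same as once. Idempotence of \<open>v_op\<close> follows.\<close>

lemma colon_v_op: "colon T (v_op T E) = colon T E"
proof
  show "colon T (v_op T E) \<subseteq> colon T E"
    by (rule colon_antimono) (rule v_op_ext)
  show "colon T E \<subseteq> colon T (v_op T E)"
    using v_op_ext[of "colon T E" T] by (simp add: v_op_def)
qed

lemma colon_scale:
  assumes "x \<noteq> 0"
  shows "colon T ((*) x ` E) = (*) (1 / x) ` colon T E"
proof
  show "colon T ((*) x ` E) \<subseteq> (*) (1 / x) ` colon T E"
  proof
    fix y assume "y \<in> colon T ((*) x ` E)"
    then have "x * y \<in> colon T E" by (auto simp: colon_def mult_ac)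
    then have "(1 / x) * (x * y) \<in> (*) (1 / x) ` colon T E" by blast
    then show "y \<in> (*) (1 / x) ` colon T E" using assms by simp
  qed
  show "(*) (1 / x) ` colon T E \<subseteq> colon T ((*) x ` E)"
    using assms by (auto simp: colon_def)
qed

lemma submodule_colon:
  assumes "is_subring T"
  shows "is_submodule T (colon T E)"
  using assms by (auto simp: is_submodule_def colon_def distrib_right mult.assoc subringD)

lemma semistar_v_op:
  assumes "is_subring T"
  shows "semistar T (v_op T)"
proof -
  have "v_op T E \<in> Fbar T" if E: "E \<in> Fbar T" for E
  proof -
    obtain e where "e \<in> E" "e \<noteq> 0" using Fbar_nonzero[OF E] by blast
    then show ?thesis
      using v_op_ext[of E T] submodule_colon[OF assms]
      unfolding v_op_def by (blast intro: FbarI)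
  qed
  \<comment> \<open>The factor \<open>x\<close> becomes \<open>1 / x\<close> in the inner colon and
    \<open>x\<close> again in the outer one.\<close>
  moreover have "v_op T ((*) x ` E) = (*) x ` v_op T E" if "x \<noteq> 0" for x E
    using that colon_scale[of "1 / x" T "colon T E"]
    by (simp add: v_op_def colon_scale del: times_divide_eq_left)
  moreover have "v_op T E \<subseteq> v_op T F" if "E \<subseteq> F" for E F
    using that unfolding v_op_def by (intro colon_antimono)
  moreover have "v_op T (v_op T E) = v_op T E" for E
    using colon_v_op[of T E] by (simp add: v_op_def)
  ultimately show ?thesis
    by (simp add: semistar_def v_op_ext)
qed

text \<open>Linkedness evaluates the operation on \<open>T\<close> only at \<open>T\<close> and at
  modules \<open>FT\<close>. These are finitely generated over \<open>T\<close>, where an operation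
  agrees with its finite-type version. It allows passing between \<open>v_op T\<close> and
  \<open>t_op T\<close>.\<close>

lemma linked_finite_type_iff:
  assumes "overring D T" "semistar T star'"
  shows "linked D star T (finite_type T star') \<longleftrightarrow> linked D star T star'"
  using assms fgmod_mod_mult[OF assms(1)] fgmod_subring[of T]
  unfolding linked_def by (auto simp: finite_type_fgmod overring_def)

text \<open>The contraction \<open>I\<close> of \<open>Q D_Q\<close> to \<open>T\<close> is shown to
  have a \<open>t\<close>-closure without 1, so it lies in a \<open>t\<close>-maximal ideal. A
  witness \<open>F\<close> against this is refuted by invertibility at \<open>Q\<close> of the
  \<open>D\<close>-module on the same generators.\<close>

lemma QSpec_le_QMax_t:
  assumes D: "domain_with_quotient_field D" and star: "semistar D star" and pmd: "PstarMD D star"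
    and T: "overring D T" and Q: "Q \<in> QSpec D (finite_type D star)" and TQ: "T \<subseteq> localization D Q"
  shows "\<exists>N\<in>QMax T (t_op T). Q \<subseteq> N"
proof -
  have ring: "is_subring D" using D by (simp add: domain_with_quotient_field_def)
  have ringT: "is_subring T" and DT: "D \<subseteq> T" using T by (auto simp: overring_def)
  have Qp: "is_prime_ideal D Q" using Q by (simp add: QSpec_def)
  have QF: "Q \<in> Fbar D" using Q quasi_ideal_Fbar by (auto simp: QSpec_def)
  \<comment> \<open>This is \<open>Q D_Q \<inter> T\<close> with denominators cleared.\<close>
  let ?I = "{x \<in> T. \<exists>c\<in>D. c \<notin> Q \<and> c * x \<in> Q}"
  have subQ: "is_submodule D Q" using QF by (rule FbarD)
  have QI: "Q \<subseteq> ?I"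
    using prime_one[OF Qp] subringD(1)[OF ring] prime_sub[OF Qp] DT
    by (auto intro!: bexI[of _ 1])
  have ID: "?I \<inter> D \<subseteq> Q"
    using prime_cases[OF Qp] by blast
  have "is_submodule T ?I"
    unfolding is_submodule_def
  proof (intro conjI ballI)
    show "0 \<in> ?I" using QI prime_zero[OF Qp] by blast
  next
    fix x y assume "x \<in> ?I" "y \<in> ?I"
    then obtain c d where *: "x \<in> T" "y \<in> T" "c \<in> D" "c \<notin> Q" "c * x \<in> Q" "d \<in> D" "d \<notin> Q" "d * y \<in> Q"
      by blast
    have "(c * d) * (x + y) = d * (c * x) + c * (d * y)" by (simp add: algebra_simps)
    then have "(c * d) * (x + y) \<in> Q" using * subQ by (simp add: submoduleD)
    moreover have "c * d \<notin> Q" "c * d \<in> D" "x + y \<in> T"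
      using * prime_cases[OF Qp] ring ringT by (auto simp: subringD)
    ultimately show "x + y \<in> ?I" by blast
  next
    fix t x assume t: "t \<in> T" and x: "x \<in> ?I"
    then obtain c where c: "x \<in> T" "c \<in> D" "c \<notin> Q" "c * x \<in> Q" by blast
    obtain a d where ad: "a \<in> D" "d \<in> D" "d \<notin> Q" "t = a / d"
      using t TQ by (blast elim: localizationE)
    have "d \<noteq> 0" using ad prime_zero[OF Qp] by auto
    then have "(d * c) * (t * x) = a * (c * x)" using ad by simp
    then have "(d * c) * (t * x) \<in> Q" using prime_mult[OF Qp] ad c by simp
    moreover have "t * x \<in> T"
      using t c(1) by (rule subringD(6)[OF ringT])
    moreover have "d * c \<notin> Q" "d * c \<in> D"
      using c ad prime_cases[OF Qp] ring by (auto simp: subringD)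
    ultimately show "t * x \<in> ?I" by blast
  qed
  then have id: "is_ideal T ?I" by (auto simp: is_ideal_def)
  have nz: "?I \<noteq> {0}" using Fbar_nonzero[OF QF] QI by blast
  have "1 \<notin> finite_type T (v_op T) ?I"
  proof
    assume "1 \<in> finite_type T (v_op T) ?I"
    then obtain F where F: "F \<in> fgmod T" "F \<subseteq> ?I" "1 \<in> v_op T F"
      by (auto simp: mem_finite_type)
    obtain S x where S: "finite S" "F = is_submodule T hull S" "x \<in> S" "x \<noteq> 0"
      using F(1) by (rule fgmodE)
    let ?G = "is_submodule D hull S"
    have "?G \<in> fgmod D" using S by (intro fgmodI[of _ x])
    then obtain g u where g: "g \<in> ?G" and u: "u \<in> colon D ?G" and gu: "g * u \<notin> Q"
      using PstarMD_not_in_QSpec[OF D star pmd Q] by blast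
    have uS: "u * y \<in> D" if "y \<in> ?G" for y using u that by (auto simp: colon_def)
    have "F \<subseteq> {y. u * y \<in> T}"
      unfolding S(2) using uS hull_inc[of _ S] DT
      by (subst hull_le_iff) (auto intro!: submodule_unscale submodule_subring ringT)
    then have "u \<in> colon T F" by (auto simp: colon_def)
    \<comment> \<open>That 1 lies in \<open>v_op T F\<close> means exactly that
      \<open>colon T F\<close> is contained in \<open>T\<close>.\<close>
    then have uT: "u \<in> T"
      using F(3) by (auto simp: v_op_def colon_def)
    have "?G \<subseteq> F"
      unfolding S(2) by (subst hull_le_iff)
        (auto intro: submodule_restrict[OF submodule_hull DT] hull_inc)
    then have "g \<in> ?I" using g F by blast
    \<comment> \<open>The product lies in \<open>I\<close> because \<open>u\<close> is in
      \<open>T\<close>, and in \<open>D\<close> because \<open>u\<close> is in the inverse of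
      \<open>G\<close>; thus it falls into \<open>Q\<close>.\<close>
    then have "u * g \<in> ?I" using submoduleD(3)[of T ?I] id uT by (auto simp: is_ideal_def)
    then have "u * g \<in> Q" using uS[OF g] ID by blast
    with gu show False by (simp add: mult.commute)
  qed
  then have "\<exists>N\<in>QMax T (finite_type T (v_op T)). ?I \<subseteq> N"
    by (intro QMax_exists ringT semistar_v_op id nz)
  with QI show ?thesis by (auto simp: t_op_def)
qed

text \<open>
  If \<open>P\<close> is not sharp, then \<open>T = \<Theta>(P)\<close> is a linked overring contained in \<open>D\<^sub>P\<close>, and no
  \<open>t\<close>-maximal ideal \<open>N\<close> of \<open>T\<close> lying over a prime that contains \<open>P\<close> is sharp: every \<open>D\<^sub>M\<close> with
  \<open>M \<in> \<nabla>(P)\<close> is the localization of \<open>T\<close> at another \<open>t\<close>-maximal ideal.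
\<close>

lemma linked_t_sharp_imp_doublesharp:
  assumes D: "domain_with_quotient_field D" and star: "semistar D star" and pmd: "PstarMD D star"
    and sharp: "\<And>T. overring D T \<Longrightarrow> linked D star T (t_op T) \<Longrightarrow> sharp_domain T (t_op T)"
  shows "doublesharp_domain D (finite_type D star)"
  unfolding doublesharp_domain_def sharp_prime_def
proof (intro ballI notI)
  let ?s = "finite_type D star"
  fix P assume P: "P \<in> QSpec D ?s" and nonsharp: "Theta D ?s P \<subseteq> localization D P"
  define T where "T = Theta D ?s P"
  have ring: "is_subring D" using D by (simp add: domain_with_quotient_field_def)
  have spec: "M \<in> QSpec D ?s" if "M \<in> nabla D ?s P" for M
    using QMax_QSpec[OF ring star] that by (auto simp: nabla_def)
  have prime: "is_prime_ideal D M" if "M \<in> nabla D ?s P" for M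
    using spec[OF that] by (simp add: QSpec_def)
  have TM: "T \<subseteq> localization D M" if "M \<in> nabla D ?s P" for M
    using that by (auto simp: T_def Theta_def)
  have ringT: "is_subring T"
    using subring_localization[OF ring prime] by (auto simp: is_subring_def T_def Theta_def)
  have DT: "D \<subseteq> T"
    using localization_inc[OF ring prime] by (auto simp: T_def Theta_def)
  have T: "overring D T" using ringT DT by (simp add: overring_def)
  have v: "semistar T (v_op T)" using ringT by (rule semistar_v_op)
  have "v_op T (mod_mult F T) = v_op T T" if F: "F \<in> fgmod D" "F \<subseteq> D" "star F = star D" for F
  proof -
    \<comment> \<open>Since \<open>star F = star D\<close>, no quasi-maximal \<open>M\<close>
      contains \<open>F\<close>. Some \<open>f\<close> in \<open>F\<close> is therefore invertible
      in \<open>D_M\<close>, and \<open>x f\<close> in \<open>T \<subseteq> D_M\<close> gives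
      \<open>x\<close> in \<open>D_M\<close>.\<close>
    have "x \<in> T" if x: "x \<in> colon T (mod_mult F T)" for x
      unfolding T_def Theta_def
    proof
      fix M assume M: "M \<in> nabla D ?s P"
      have "1 \<in> star F"
        using F(3) semistarD(4)[OF star Fbar_subring[OF ring]] subringD(1)[OF ring] by auto
      then have "1 \<in> ?s M" if "F \<subseteq> M"
        using that F by (auto simp: mem_finite_type)
      moreover have "quasi_ideal D ?s M" "M \<noteq> D"
        using M by (auto simp: nabla_def QMax_def)
      ultimately obtain f where f: "f \<in> F" "f \<notin> M"
        using quasi_ideal_one_notin[OF ring] by blast
      have fD: "f \<in> D" using f F by blast
      have "f \<in> mod_mult F T" using f mod_mult_overring_inc[OF ringT] by blast
      then have "x * f \<in> localization D M" using x TM[OF M] by (auto simp: colon_def)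
      moreover have "1 / f \<in> localization D M"
        using f fD subringD(1)[OF ring] by (auto intro: localizationI)
      ultimately have "x * f * (1 / f) \<in> localization D M"
        by (rule localization_mult[OF ring prime[OF M]])
      moreover have "f \<noteq> 0" using f prime_zero[OF prime[OF M]] by auto
      ultimately show "x \<in> localization D M" by simp
    qed
    then have "colon T (mod_mult F T) \<subseteq> T" ..
    also have "T \<subseteq> colon T T"
      using subringD(6)[OF ringT] by (simp add: colon_def subset_iff)
    finally have "colon T (mod_mult F T) \<subseteq> colon T T" .
    moreover have "mod_mult F T \<subseteq> T"
      using F(2) DT by (intro mod_mult_overring_le[OF DT] submodule_subring[OF ringT]) auto
    then have "colon T T \<subseteq> colon T (mod_mult F T)" by (rule colon_antimono)
    ultimately show ?thesis by (simp add: v_op_def)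
  qed
  then have link: "linked D star T (v_op T)" by (simp add: linked_def)
  then have "sharp_domain T (t_op T)"
    using sharp[OF T] linked_finite_type_iff[OF T v] by (simp add: t_op_def)
  note con = linked_contraction_QSpec(1)[OF D star pmd T v link, folded t_op_def]
  have loc: "localization T N = localization D (N \<inter> D)" if "N \<in> QMax T (t_op T)" for N
    using localization_contraction[OF D star pmd T _ con[OF that]] QMax_prime[OF ringT v, of N] that
    by (simp add: t_op_def)
  \<comment> \<open>Failure of sharpness says that \<open>T\<close> is contained in
    \<open>D_P\<close>, which is what the lemma requires.\<close>
  obtain N where N: "N \<in> QMax T (t_op T)" "P \<subseteq> N"
    using QSpec_le_QMax_t[OF D star pmd T P] nonsharp by (auto simp: T_def)
  have "Theta T (t_op T) N \<subseteq> localization D M" if M: "M \<in> nabla D ?s P" for M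
  proof -
    have MQ: "M \<in> QMax D ?s" "\<not> P \<subseteq> M" using M by (auto simp: nabla_def)
    obtain N' where N': "N' \<in> QMax T (t_op T)" "M \<subseteq> N'"
      using QSpec_le_QMax_t[OF D star pmd T spec[OF M] TM[OF M]] by blast
    have "M \<subseteq> N' \<inter> D"
      using N' prime_sub[OF prime[OF M]] by blast
    \<comment> \<open>The contraction of \<open>N'\<close> is a proper quasi-ideal containing the
      quasi-maximal ideal \<open>M\<close>.\<close>
    then have eq: "N' \<inter> D = M"
      using MQ con[OF N'(1)] by (auto simp: QMax_def QSpec_def is_prime_ideal_def)
    have "P \<subseteq> D" using P prime_sub by (auto simp: QSpec_def)
    \<comment> \<open>An inclusion would put \<open>P\<close> inside
      \<open>N' \<inter> D = M\<close>, contrary to the choice of \<open>M\<close>.\<close>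
    then have "\<not> N \<subseteq> N'"
      using N eq MQ by blast
    then have "N' \<in> nabla T (t_op T) N" using N' by (simp add: nabla_def)
    then have "Theta T (t_op T) N \<subseteq> localization T N'" by (auto simp: Theta_def)
    then show ?thesis
      using loc[OF N'(1)] eq by simp
  qed
  then have "Theta T (t_op T) N \<subseteq> T"
    unfolding T_def Theta_def[of D] by (rule INT_greatest)
  moreover have "T \<subseteq> localization T N"
    using localization_inc[OF ringT] QMax_prime[OF ringT v] N by (simp add: t_op_def)
  ultimately show False
    using \<open>sharp_domain T (t_op T)\<close> N unfolding sharp_domain_def sharp_prime_def by blast
qed

theorem corollary3p7:
  fixes D :: "'k::field set" and star :: "'k set \<Rightarrow> 'k set"
  assumes "domain_with_quotient_field D"
    and "semistar D star"
    and "PstarMD D star"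
  shows "(doublesharp_domain D (finite_type D star) \<longleftrightarrow>
            (\<forall>T star'. overring D T \<and> semistar T star' \<and> linked D star T star' \<longrightarrow>
               sharp_domain T (finite_type T star'))) \<and>
         ((\<forall>T star'. overring D T \<and> semistar T star' \<and> linked D star T star' \<longrightarrow>
               sharp_domain T (finite_type T star')) \<longleftrightarrow>
            (\<forall>T. overring D T \<and> linked D star T (t_op T) \<longrightarrow> sharp_domain T (t_op T)))"
    (is "(?i \<longleftrightarrow> ?ii) \<and> (?ii \<longleftrightarrow> ?iii)")
proof -
  have "?i \<Longrightarrow> ?ii"
    using doublesharp_imp_linked_sharp[OF assms] by blast
  \<comment> \<open>The operation taken in (ii) is \<open>v_op T\<close>, whose finite-type version
    is \<open>t_op T\<close>; linkedness is the same for both.\<close>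
  moreover have "?ii \<Longrightarrow> ?iii"
    using semistar_v_op linked_finite_type_iff unfolding t_op_def overring_def by blast
  moreover have "?iii \<Longrightarrow> ?i"
    using linked_t_sharp_imp_doublesharp[OF assms] by blast
  ultimately show ?thesis by blast
qed

end
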